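(* Let $\mathcal A$ be a $C^*$-algebra, let $\mathcal X$ and $\mathcal Y$ be Hilbert $\mathcal A$-modules, and let $\varphi:\mathcal X\times\mathcal Y\to[0,\infty)$ be a function. Let $f$ be a (not necessarily linear) mapping from $\mathcal D(f)\subseteq\mathcal X$ to $\mathcal Y$ that is a $\varphi$-perturbation of an adjointable mapping with corresponding (not necessarily linear) mapping $g$ from $\mathcal D(g)\subseteq\mathcal Y$ to $\mathcal X$, i.e. $$\|\langle f(x),y\rangle-\langle x,g(y)\rangle\|\le\varphi(x,y)\qquad(x\in\mathcal D(f),\ y\in\mathcal D(g)).$$ Suppose that the mappings $f$ and $g$ are densely defined on the respective Hilbert $C^*$-modules, i.e. $\mathcal D(f)$ and $\mathcal D(g)$ are norm-dense subsets of $\mathcal X$ and $\mathcal Y$, respectively. Furthermore, suppose that for some sequence $\{c_n\}$ of non-zero complex numbers either both of the conditions $$\lim_{n\to\infty}|c_n|^{-1}\varphi(c_nx,y)=0\quad\text{and}\quad \lim_{n\to\infty}|c_n|^{-1}\varphi(x,c_ny)=0\qquad(x\in\mathcal X,\ y\in\mathcal Y)$$ hold, or both of the conditions $$\lim_{n\to\infty}|c_n|\,\varphi(c_n^{-1}x,y)=0\quad\text{and}\quad \lim_{n\to\infty}|c_n|\,\varphi(x,c_n^{-1}y)=0\qquad(x\in\mathcal X,\ y\in\mathcal Y)$$ hold. Then $f$ is adjointable. In particular, $f$ is $\mathcal A$-linear, and its adjoint is $g$.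
   Context: A (right) Hilbert $\mathcal A$-module is a complex linear space $\mathcal X$ that is a right $\mathcal A$-module with $\lambda(xa)=x(\lambda a)=(\lambda x)a$ for $x\in\mathcal X$, $a\in\mathcal A$, $\lambda\in\mathbb C$, equipped with an $\mathcal A$-valued inner product $\langle\cdot,\cdot\rangle:\mathcal X\times\mathcal X\to\mathcal A$ satisfying: (i) $\langle x,x\rangle\ge0$, with $\langle x,x\rangle=0$ iff $x=0$; (ii) $\langle x,y+\lambda z\rangle=\langle x,y\rangle+\lambda\langle x,z\rangle$; (iii) $\langle x,ya\rangle=\langle x,y\rangle a$; (iv) $\langle x,y\rangle^*=\langle y,x\rangle$; and complete for the norm $\|x\|=\|\langle x,x\rangle\|^{1/2}$. A densely defined mapping $f$ from $\mathcal D(f)\subseteq\mathcal X$ to $\mathcal Y$ (no linearity assumed) is called adjointable if there is a densely defined mapping $g$ from $\mathcal D(g)\subseteq\mathcal Y$ to $\mathcal X$ with $\langle f(x),y\rangle=\langle x,g(y)\rangle$ for all $x\in\mathcal D(f)$, $y\in\mathcal D(g)$; the mapping $g$ is then called the adjoint of $f$. $\mathcal A$-linear means $\mathbb C$-linear and commuting with the right $\mathcal A$-action.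
   Formalization: The domains D(f) and D(g) are additionally assumed closed under multiplication by each c_n (first case) or c_n^{-1} (second case), without which the claim fails; f being A-linear means it is the restriction of an A-linear map on a submodule containing D(f). *)

theory Defs
  imports "HOL-Analysis.Analysis"
begin

section \<open>Complex normed spaces and C*-algebras\<close>

class complex_vector = real_vector +
  fixes scaleC :: "complex \<Rightarrow> 'a \<Rightarrow> 'a" (infixr "*\<^sub>C" 75)
  assumes scaleC_add_right: "z *\<^sub>C (x + y) = z *\<^sub>C x + z *\<^sub>C y"
    and scaleC_add_left: "(z + w) *\<^sub>C x = z *\<^sub>C x + w *\<^sub>C x"
    and scaleC_scaleC: "z *\<^sub>C w *\<^sub>C x = (z * w) *\<^sub>C x"
    and scaleC_one: "1 *\<^sub>C x = x"
    and scaleR_scaleC: "r *\<^sub>R x = complex_of_real r *\<^sub>C x"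

class complex_normed_vector = complex_vector + real_normed_vector +
  assumes norm_scaleC: "norm (z *\<^sub>C x) = cmod z * norm x"

text \<open>No unit is required.\<close>

class cstar_algebra = complex_normed_vector + real_normed_algebra + complete_space +
  fixes star :: "'a \<Rightarrow> 'a"
  assumes scaleC_mult_left: "(z *\<^sub>C a) * b = z *\<^sub>C (a * b)"
    and scaleC_mult_right: "a * (z *\<^sub>C b) = z *\<^sub>C (a * b)"
    and star_star: "star (star a) = a"
    and star_add: "star (a + b) = star a + star b"
    and star_scaleC: "star (z *\<^sub>C a) = cnj z *\<^sub>C star a"
    and star_mult: "star (a * b) = star b * star a"
    and cstar_identity: "norm (star a * a) = (norm a)\<^sup>2"

text \<open>
  The pair \<open>(a, z)\<close> stands for the element \<open>a + z1\<close> of the algebra obtained by adjoining a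
  unit \<open>1 = (0, 1)\<close>.  The spectrum below is the one computed there; if the algebra already has
  a unit it differs from the spectrum in the algebra itself by at most the point \<open>0\<close>, which
  does not affect positivity.
\<close>

definition unitization_mult ::
    "'a::cstar_algebra \<times> complex \<Rightarrow> 'a \<times> complex \<Rightarrow> 'a \<times> complex" where
  "unitization_mult = (\<lambda>(a, z) (b, w). (a * b + w *\<^sub>C a + z *\<^sub>C b, z * w))"

definition cstar_spectrum :: "'a::cstar_algebra \<Rightarrow> complex set" where
  "cstar_spectrum a = {z. \<nexists>u. unitization_mult (a, - z) u = (0, 1) \<and>
                              unitization_mult u (a, - z) = (0, 1)}"

definition cstar_positive :: "'a::cstar_algebra \<Rightarrow> bool" where
  "cstar_positive a \<longleftrightarrow> star a = a \<and> cstar_spectrum a \<subseteq> complex_of_real ` {0..}"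


section \<open>Hilbert C*-modules\<close>

text \<open>
  The norm and the completeness of the module are those of its type: \<open>norm_eq\<close> ties the norm of
  the type to the inner product.  That this norm is indeed a norm is part of the sort of \<open>'x\<close>;
  in the theory of Hilbert modules it is a consequence of the remaining axioms.
\<close>

locale hilbert_module =
  fixes act :: "'x::{complex_normed_vector, complete_space} \<Rightarrow> 'a::cstar_algebra \<Rightarrow> 'x"
    and ip :: "'x \<Rightarrow> 'x \<Rightarrow> 'a"
  assumes act_add_left: "act (x + y) a = act x a + act y a"
    and act_add_right: "act x (a + b) = act x a + act x b"
    and act_mult: "act x (a * b) = act (act x a) b"
    and scaleC_act_right: "z *\<^sub>C act x a = act x (z *\<^sub>C a)"
    and scaleC_act_left: "z *\<^sub>C act x a = act (z *\<^sub>C x) a"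
    and ip_positive: "cstar_positive (ip x x)"
    and ip_definite: "ip x x = 0 \<longleftrightarrow> x = 0"
    and ip_linear_right: "ip x (y + z *\<^sub>C w) = ip x y + z *\<^sub>C ip x w"
    and ip_act_right: "ip x (act y a) = ip x y * a"
    and ip_star: "star (ip x y) = ip y x"
    and norm_eq: "norm x = sqrt (norm (ip x x))"


section \<open>Partially defined mappings\<close>

text \<open>
  A mapping from \<open>D \<subseteq> 'x\<close> to \<open>'y\<close> is given by its domain \<open>D\<close> and a total function whose values
  outside \<open>D\<close> are irrelevant.
\<close>

definition densely_defined :: "'x::topological_space set \<Rightarrow> bool" where
  "densely_defined D \<longleftrightarrow> closure D = UNIV"

definition is_adjoint ::
    "('x::topological_space \<Rightarrow> 'x \<Rightarrow> 'a) \<Rightarrow> ('y::topological_space \<Rightarrow> 'y \<Rightarrow> 'a) \<Rightarrow>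
     'x set \<Rightarrow> ('x \<Rightarrow> 'y) \<Rightarrow> 'y set \<Rightarrow> ('y \<Rightarrow> 'x) \<Rightarrow> bool" where
  "is_adjoint ipX ipY Df f Dg g \<longleftrightarrow>
     densely_defined Dg \<and> (\<forall>x\<in>Df. \<forall>y\<in>Dg. ipY (f x) y = ipX x (g y))"

definition adjointable ::
    "('x::topological_space \<Rightarrow> 'x \<Rightarrow> 'a) \<Rightarrow> ('y::topological_space \<Rightarrow> 'y \<Rightarrow> 'a) \<Rightarrow>
     'x set \<Rightarrow> ('x \<Rightarrow> 'y) \<Rightarrow> bool" where
  "adjointable ipX ipY Df f \<longleftrightarrow>
     densely_defined Df \<and> (\<exists>Dg g. is_adjoint ipX ipY Df f Dg g)"

definition submodule :: "('x::complex_vector \<Rightarrow> 'a \<Rightarrow> 'x) \<Rightarrow> 'x set \<Rightarrow> bool" where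
  "submodule act M \<longleftrightarrow> 0 \<in> M \<and> (\<forall>x\<in>M. \<forall>y\<in>M. x + y \<in> M) \<and>
     (\<forall>z. \<forall>x\<in>M. z *\<^sub>C x \<in> M) \<and> (\<forall>x\<in>M. \<forall>a. act x a \<in> M)"

definition linear_map_on_submodule ::
    "('x::complex_vector \<Rightarrow> 'a \<Rightarrow> 'x) \<Rightarrow> ('y::complex_vector \<Rightarrow> 'a \<Rightarrow> 'y) \<Rightarrow>
     'x set \<Rightarrow> ('x \<Rightarrow> 'y) \<Rightarrow> bool" where
  "linear_map_on_submodule actX actY M f \<longleftrightarrow> submodule actX M \<and>
     (\<forall>x\<in>M. \<forall>y\<in>M. f (x + y) = f x + f y) \<and>
     (\<forall>z. \<forall>x\<in>M. f (z *\<^sub>C x) = z *\<^sub>C f x) \<and>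
     (\<forall>x\<in>M. \<forall>a. f (actX x a) = actY (f x) a)"

text \<open>
  The domain \<open>D\<close> is not required to be a submodule, so \<open>\<A>\<close>-linearity on \<open>D\<close> means being the
  restriction of an \<open>\<A>\<close>-linear map defined on a submodule.  In particular \<open>f\<close> then respects every
  linear combination of elements of \<open>D\<close> with coefficients in \<open>\<complex>\<close> and in \<open>\<A>\<close> that lies in \<open>D\<close>.
\<close>

definition A_linear_on ::
    "('x::complex_vector \<Rightarrow> 'a \<Rightarrow> 'x) \<Rightarrow> ('y::complex_vector \<Rightarrow> 'a \<Rightarrow> 'y) \<Rightarrow>
     'x set \<Rightarrow> ('x \<Rightarrow> 'y) \<Rightarrow> bool" where
  "A_linear_on actX actY D f \<longleftrightarrow>
     (\<exists>M F. D \<subseteq> M \<and> linear_map_on_submodule actX actY M F \<and> (\<forall>x\<in>D. F x = f x))"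

lemma A_linear_on_submodule_iff:
  assumes "submodule actX D"
  shows "A_linear_on actX actY D f \<longleftrightarrow> linear_map_on_submodule actX actY D f"
proof
  assume "A_linear_on actX actY D f"
  then obtain M F where M: "D \<subseteq> M" and F: "linear_map_on_submodule actX actY M F"
    and eq: "\<And>x. x \<in> D \<Longrightarrow> F x = f x"
    unfolding A_linear_on_def by blast
  have D: "x + y \<in> D" "z *\<^sub>C x \<in> D" "actX x a \<in> D" if "x \<in> D" "y \<in> D" for x y z a
    using assms that unfolding submodule_def by simp_all
  have add: "F (x + y) = F x + F y" if "x \<in> M" "y \<in> M" for x y
    using F that unfolding linear_map_on_submodule_def by simp
  have scale: "F (z *\<^sub>C x) = z *\<^sub>C F x" if "x \<in> M" for x z
    using F that unfolding linear_map_on_submodule_def by simp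
  have act: "F (actX x a) = actY (F x) a" if "x \<in> M" for x a
    using F that unfolding linear_map_on_submodule_def by simp
  show "linear_map_on_submodule actX actY D f"
    unfolding linear_map_on_submodule_def
  proof (intro conjI ballI allI)
    show "submodule actX D" by (fact assms)
  next
    fix x y assume "x \<in> D" "y \<in> D"
    then show "f (x + y) = f x + f y"
      using add[of x y] eq[of x] eq[of y] eq[of "x + y"] D(1)[of x y] M by (simp add: subset_iff)
  next
    fix z x assume "x \<in> D"
    then show "f (z *\<^sub>C x) = z *\<^sub>C f x"
      using scale[of x z] eq[of x] eq[of "z *\<^sub>C x"] D(2)[of x x z] M by (simp add: subset_iff)
  next
    fix x a assume "x \<in> D"
    then show "f (actX x a) = actY (f x) a"
      using act[of x a] eq[of x] eq[of "actX x a"] D(3)[of x x a] M by (simp add: subset_iff)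
  qed
next
  assume "linear_map_on_submodule actX actY D f"
  then show "A_linear_on actX actY D f"
    unfolding A_linear_on_def by blast
qed

text \<open>
  Closure of the domains under the scalars \<open>c n\<close>: the perturbation estimate can only be
  evaluated at \<open>c n *\<^sub>C x\<close> if this vector belongs to the domain.
\<close>

definition closed_under_scalars :: "(nat \<Rightarrow> complex) \<Rightarrow> 'x::complex_vector set \<Rightarrow> bool" where
  "closed_under_scalars c D \<longleftrightarrow> (\<forall>n. \<forall>x\<in>D. c n *\<^sub>C x \<in> D)"

end

theory Submission
  imports Defs
begin

text \<open>
  The hypothesis bounds the defect of the adjunction at \<open>(x, y)\<close> by \<open>phi x y\<close>, and \<open>phi\<close> is
  negligible along rescalings: writing \<open>d n\<close> for \<open>c n\<close> or for \<open>1 / c n\<close>, whichever alternative holds,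
  \<open>phi (d n x) y\<close> and \<open>phi x (d n y)\<close> are both of order \<open>o(|d n|)\<close>.  Rescaling the second argument
  recovers \<open>\<langle>f x, y\<rangle>\<close> as the limit of \<open>\<langle>x, g (d n y)\<rangle> / d n\<close>.  These approximants are conjugate
  linear in \<open>x\<close>, so \<open>\<langle>f (d m x), y\<rangle>\<close> equals \<open>cnj (d m) \<langle>f x, y\<rangle>\<close> for every \<open>m\<close>.  Rescaling the
  first argument instead gives the limit \<open>\<langle>x, g y\<rangle>\<close> for \<open>\<langle>f (d m x), y\<rangle> / cnj (d m)\<close>; this sequence
  has just been seen to be constant with value \<open>\<langle>f x, y\<rangle>\<close>, so the defect is zero
  (lemma \<open>perturbed_adjoint_is_exact\<close>).

  Linearity then follows from exact adjunction (lemma \<open>has_adjoint_imp_A_linear_on\<close>): the pairs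
  \<open>(x, v)\<close> with \<open>\<langle>v, y\<rangle> = \<langle>x, g y\<rangle>\<close> for all \<open>y \<in> Dg\<close> form a submodule of the product, and this
  submodule is the graph of a map because only \<open>0\<close> is orthogonal to a dense set.  That map extends \<open>f\<close>.

  The last fact about orthogonality would usually be drawn from the Cauchy-Schwarz inequality, which
  depends on the order structure of the algebra.  A parallelogram argument
  (lemma \<open>orthogonal_to_dense_imp_zero\<close>) gets it from continuity of the norm alone.
\<close>

section \<open>Scaling in complex normed spaces\<close>

lemma scaleC_minus_one: "(- 1) *\<^sub>C (x::'a::complex_vector) = - x"
  using scaleR_scaleC[of "- 1" x] by simp

lemma scaleC_minus_right: "z *\<^sub>C (- x) = - (z *\<^sub>C (x::'a::complex_vector))"
  by (metis mult.commute scaleC_minus_one scaleC_scaleC)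

lemma scaleC_diff_right: "z *\<^sub>C (x - y) = z *\<^sub>C x - z *\<^sub>C (y::'a::complex_vector)"
  using scaleC_add_right[of z x "- y"] by (simp add: scaleC_minus_right)

lemma tendsto_scaleC:
  fixes X :: "nat \<Rightarrow> 'a::complex_normed_vector"
  assumes "X \<longlonglongrightarrow> L"
  shows "(\<lambda>n. z *\<^sub>C X n) \<longlonglongrightarrow> z *\<^sub>C L"
proof -
  have "(\<lambda>n. cmod z * norm (X n - L)) \<longlonglongrightarrow> 0"
    using tendsto_mult_right_zero[OF tendsto_norm_zero[OF LIM_zero[OF assms]]] by simp
  then have "(\<lambda>n. z *\<^sub>C X n - z *\<^sub>C L) \<longlonglongrightarrow> 0"
    by - (rule tendsto_norm_zero_cancel, simp add: norm_scaleC flip: scaleC_diff_right)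
  then show ?thesis
    by (rule LIM_zero_cancel)
qed

lemma rescaled_approximation_tendsto:
  fixes a :: "nat \<Rightarrow> 'a::complex_normed_vector"
  assumes nz: "\<And>n. d n \<noteq> 0"
    and bound: "\<And>n. norm (a n - d n *\<^sub>C b) \<le> p n"
    and small: "(\<lambda>n. inverse (cmod (d n)) * p n) \<longlonglongrightarrow> 0"
  shows "(\<lambda>n. inverse (d n) *\<^sub>C a n) \<longlonglongrightarrow> b"
proof -
  have "norm (inverse (d n) *\<^sub>C a n - b) \<le> inverse (cmod (d n)) * p n" for n
  proof -
    have "inverse (d n) *\<^sub>C a n - b = inverse (d n) *\<^sub>C (a n - d n *\<^sub>C b)"
      using nz[of n] by (simp add: scaleC_diff_right scaleC_scaleC scaleC_one)
    then show ?thesis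
      using bound[of n] by (simp add: norm_scaleC norm_inverse mult_left_mono)
  qed
  then have "(\<lambda>n. inverse (d n) *\<^sub>C a n - b) \<longlonglongrightarrow> 0"
    by (intro Lim_null_comparison[OF _ small] always_eventually allI)
  then show ?thesis
    by (rule LIM_zero_cancel)
qed

section \<open>Inner products and orthogonality\<close>

context hilbert_module
begin

lemma ip_add_right: "ip x (y + w) = ip x y + ip x w"
  using ip_linear_right[of x y 1 w] by (simp add: scaleC_one)

lemma ip_zero_right: "ip x 0 = 0"
  using ip_add_right[of x 0 0] by simp

lemma ip_scaleC_right: "ip x (z *\<^sub>C y) = z *\<^sub>C ip x y"
  using ip_linear_right[of x 0 z y] by (simp add: ip_zero_right)

lemma ip_minus_right: "ip x (- y) = - ip x y"
  using ip_scaleC_right[of x "- 1" y] by (simp add: scaleC_minus_one)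

lemma ip_add_left: "ip (x + y) w = ip x w + ip y w"
  by (metis ip_add_right ip_star star_add)

lemma ip_scaleC_left: "ip (z *\<^sub>C x) y = cnj z *\<^sub>C ip x y"
  by (metis ip_scaleC_right ip_star star_scaleC)

lemma ip_minus_left: "ip (- x) y = - ip x y"
  using ip_scaleC_left[of "- 1" x y] by (simp add: scaleC_minus_one)

lemma ip_zero_left: "ip 0 y = 0"
  using ip_add_left[of 0 0 y] by simp

lemma ip_diff_left: "ip (x - y) w = ip x w - ip y w"
  using ip_add_left[of x "- y" w] by (simp add: ip_minus_left)

lemma ip_diff_right: "ip x (y - w) = ip x y - ip x w"
  using ip_add_right[of x y "- w"] by (simp add: ip_minus_right)

lemma ip_act_left: "ip (act x a) y = star a * ip x y"
  by (metis ip_act_right ip_star star_mult)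

lemma norm_diff_eq_norm_add_of_orthogonal:
  assumes "ip v y = 0"
  shows "norm (v - y) = norm (v + y)"
proof -
  have "ip y v = 0"
    using assms by (metis ip_star ip_zero_right)
  with assms show ?thesis
    by (simp add: norm_eq ip_add_left ip_add_right ip_diff_left ip_diff_right)
qed

text \<open>
  If \<open>y\<close> is orthogonal to \<open>v\<close> then \<open>v - y\<close> and \<open>v + y\<close> have the same norm.  As \<open>y\<close> approaches \<open>v\<close>
  through the dense set, one norm tends to \<open>0\<close> and the other to \<open>2 \<parallel>v\<parallel>\<close>.
\<close>

lemma orthogonal_to_dense_imp_zero:
  assumes "densely_defined D" and orth: "\<And>y. y \<in> D \<Longrightarrow> ip v y = 0"
  shows "v = 0"
proof -
  have "v \<in> closure D"
    using assms(1) by (simp add: densely_defined_def)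
  then obtain y where y: "\<And>n. y n \<in> D" and lim: "y \<longlonglongrightarrow> v"
    by (auto simp: closure_sequential)
  have "(\<lambda>n. norm (v - y n)) \<longlonglongrightarrow> norm (v - v)"
    by (intro tendsto_intros lim)
  moreover have "(\<lambda>n. norm (v + y n)) \<longlonglongrightarrow> norm (v + v)"
    by (intro tendsto_intros lim)
  moreover have "(\<lambda>n. norm (v - y n)) = (\<lambda>n. norm (v + y n))"
    by (intro ext norm_diff_eq_norm_add_of_orthogonal orth y)
  ultimately have "norm (v + v) = norm (v - v)"
    by (metis LIMSEQ_unique)
  then have "2 *\<^sub>R v = 0"
    by (simp add: scaleR_2)
  then show ?thesis
    by simp
qed

lemma eq_of_ip_eq_on_dense:
  assumes "densely_defined D" and "\<And>y. y \<in> D \<Longrightarrow> ip u y = ip v y"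
  shows "u = v"
  using orthogonal_to_dense_imp_zero[of D "u - v"] assms by (simp add: ip_diff_left)

end

section \<open>Linearity of maps with an adjoint\<close>

text \<open>
  The extension that witnesses linearity is the adjoint of \<open>g\<close> on its largest possible domain.
\<close>

lemma has_adjoint_imp_A_linear_on:
  assumes X: "hilbert_module actX ipX" and Y: "hilbert_module actY ipY"
    and adj: "is_adjoint ipX ipY Df f Dg g"
  shows "A_linear_on actX actY Df f"
proof -
  interpret X: hilbert_module actX ipX by (fact X)
  interpret Y: hilbert_module actY ipY by (fact Y)
  define R where "R x v \<longleftrightarrow> (\<forall>y\<in>Dg. ipY v y = ipX x (g y))" for x v
  define M where "M = {x. \<exists>v. R x v}"
  define F where "F x = (SOME v. R x v)" for x
  have dense: "densely_defined Dg"
    using adj by (simp add: is_adjoint_def)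
  have R_unique: "u = v" if "R x u" "R x v" for x u v
    using that by (intro Y.eq_of_ip_eq_on_dense[OF dense]) (simp add: R_def)
  have R_F: "R x (F x)" if "x \<in> M" for x
    using that unfolding M_def F_def by (simp add: someI_ex)
  have R_in: "x \<in> M" if "R x v" for x v
    using that by (auto simp: M_def)
  have F_eq: "F x = v" if "R x v" for x v
    using R_unique[OF R_F[OF R_in[OF that]] that] .
  have R_zero: "R 0 0"
    by (simp add: R_def X.ip_zero_left Y.ip_zero_left)
  have R_add: "R (x + x') (v + v')" if "R x v" "R x' v'" for x x' v v'
    using that by (simp add: R_def X.ip_add_left Y.ip_add_left)
  have R_scale: "R (z *\<^sub>C x) (z *\<^sub>C v)" if "R x v" for x v z
    using that by (simp add: R_def X.ip_scaleC_left Y.ip_scaleC_left)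
  have R_act: "R (actX x a) (actY v a)" if "R x v" for x v a
    using that by (simp add: R_def X.ip_act_left Y.ip_act_left)
  have R_f: "R x (f x)" if "x \<in> Df" for x
    using adj that by (simp add: is_adjoint_def R_def)
  have "submodule actX M"
    unfolding submodule_def
    by (intro conjI ballI allI)
      (fact R_in[OF R_zero] R_in[OF R_add[OF R_F R_F]] R_in[OF R_scale[OF R_F]] R_in[OF R_act[OF R_F]])+
  then have "linear_map_on_submodule actX actY M F"
    unfolding linear_map_on_submodule_def
    by (simp add: F_eq[OF R_add[OF R_F R_F]] F_eq[OF R_scale[OF R_F]] F_eq[OF R_act[OF R_F]])
  moreover have "Df \<subseteq> M"
    using R_in[OF R_f] by blast
  moreover have "\<forall>x\<in>Df. F x = f x"
    using F_eq[OF R_f] by blast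
  ultimately show ?thesis
    unfolding A_linear_on_def by blast
qed

section \<open>Vanishing of the perturbation\<close>

lemma perturbed_adjoint_is_exact:
  assumes X: "hilbert_module actX ipX" and Y: "hilbert_module actY ipY"
    and bound: "\<And>x y. x \<in> Df \<Longrightarrow> y \<in> Dg \<Longrightarrow> norm (ipY (f x) y - ipX x (g y)) \<le> phi x y"
    and nz: "\<And>n. d n \<noteq> 0"
    and Df: "closed_under_scalars d Df" and Dg: "closed_under_scalars d Dg"
    and small_left: "\<And>x y. (\<lambda>n. inverse (cmod (d n)) * phi (d n *\<^sub>C x) y) \<longlonglongrightarrow> 0"
    and small_right: "\<And>x y. (\<lambda>n. inverse (cmod (d n)) * phi x (d n *\<^sub>C y)) \<longlonglongrightarrow> 0"
    and x: "x \<in> Df" and y: "y \<in> Dg"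
  shows "ipY (f x) y = ipX x (g y)"
proof -
  interpret X: hilbert_module actX ipX by (fact X)
  interpret Y: hilbert_module actY ipY by (fact Y)
  have dx: "d n *\<^sub>C x \<in> Df" and dy: "d n *\<^sub>C y \<in> Dg" for n
    using Df Dg x y by (auto simp: closed_under_scalars_def)
  have lim_right: "(\<lambda>n. inverse (d n) *\<^sub>C ipX u (g (d n *\<^sub>C y))) \<longlonglongrightarrow> ipY (f u) y"
    if "u \<in> Df" for u
  proof (rule rescaled_approximation_tendsto[where p = "\<lambda>n. phi u (d n *\<^sub>C y)"])
    show "norm (ipX u (g (d n *\<^sub>C y)) - d n *\<^sub>C ipY (f u) y) \<le> phi u (d n *\<^sub>C y)" for n
      using bound[OF that dy[of n]] by (simp add: Y.ip_scaleC_right norm_minus_commute)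
  qed (fact nz small_right)+
  have homogeneous: "ipY (f (d m *\<^sub>C x)) y = cnj (d m) *\<^sub>C ipY (f x) y" for m
  proof (rule LIMSEQ_unique[OF lim_right[OF dx]])
    show "(\<lambda>n. inverse (d n) *\<^sub>C ipX (d m *\<^sub>C x) (g (d n *\<^sub>C y)))
            \<longlonglongrightarrow> cnj (d m) *\<^sub>C ipY (f x) y"
      using tendsto_scaleC[OF lim_right[OF x], of "cnj (d m)"]
      by (simp add: X.ip_scaleC_left scaleC_scaleC mult.commute)
  qed
  have "(\<lambda>n. inverse (cnj (d n)) *\<^sub>C ipY (f (d n *\<^sub>C x)) y) \<longlonglongrightarrow> ipX x (g y)"
  proof (rule rescaled_approximation_tendsto[where p = "\<lambda>n. phi (d n *\<^sub>C x) y"])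
    show "norm (ipY (f (d n *\<^sub>C x)) y - cnj (d n) *\<^sub>C ipX x (g y)) \<le> phi (d n *\<^sub>C x) y" for n
      using bound[OF dx[of n] y] by (simp add: X.ip_scaleC_left)
  qed (use nz small_left in simp_all)
  moreover have "inverse (cnj (d n)) *\<^sub>C ipY (f (d n *\<^sub>C x)) y = ipY (f x) y" for n
    using nz[of n] by (simp add: homogeneous scaleC_scaleC scaleC_one)
  ultimately show ?thesis
    by (simp add: LIMSEQ_const_iff)
qed

theorem theorem2p6:
  fixes actX :: "'x::{complex_normed_vector, complete_space} \<Rightarrow> 'a::cstar_algebra \<Rightarrow> 'x"
    and ipX :: "'x \<Rightarrow> 'x \<Rightarrow> 'a"
    and actY :: "'y::{complex_normed_vector, complete_space} \<Rightarrow> 'a \<Rightarrow> 'y"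
    and ipY :: "'y \<Rightarrow> 'y \<Rightarrow> 'a"
    and phi :: "'x \<Rightarrow> 'y \<Rightarrow> real"
    and Df :: "'x set" and f :: "'x \<Rightarrow> 'y"
    and Dg :: "'y set" and g :: "'y \<Rightarrow> 'x"
    and c :: "nat \<Rightarrow> complex"
  assumes "hilbert_module actX ipX"
    and "hilbert_module actY ipY"
    and "\<And>x y. 0 \<le> phi x y"
    and "\<And>x y. x \<in> Df \<Longrightarrow> y \<in> Dg \<Longrightarrow> norm (ipY (f x) y - ipX x (g y)) \<le> phi x y"
    and "densely_defined Df"
    and "densely_defined Dg"
    and "\<And>n. c n \<noteq> 0"
    and "(closed_under_scalars c Df \<and> closed_under_scalars c Dg \<and>
          (\<forall>x y. ((\<lambda>n. inverse (cmod (c n)) * phi (c n *\<^sub>C x) y) \<longlonglongrightarrow> 0) \<and>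
                 ((\<lambda>n. inverse (cmod (c n)) * phi x (c n *\<^sub>C y)) \<longlonglongrightarrow> 0)))
       \<or> (closed_under_scalars (\<lambda>n. inverse (c n)) Df \<and>
          closed_under_scalars (\<lambda>n. inverse (c n)) Dg \<and>
          (\<forall>x y. ((\<lambda>n. cmod (c n) * phi (inverse (c n) *\<^sub>C x) y) \<longlonglongrightarrow> 0) \<and>
                 ((\<lambda>n. cmod (c n) * phi x (inverse (c n) *\<^sub>C y)) \<longlonglongrightarrow> 0)))"
  shows "adjointable ipX ipY Df f \<and> A_linear_on actX actY Df f \<and> is_adjoint ipX ipY Df f Dg g"
proof -
  have "\<exists>d. (\<forall>n. d n \<noteq> 0) \<and> closed_under_scalars d Df \<and> closed_under_scalars d Dg \<and>
          (\<forall>x y. ((\<lambda>n. inverse (cmod (d n)) * phi (d n *\<^sub>C x) y) \<longlonglongrightarrow> 0) \<and>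
                 ((\<lambda>n. inverse (cmod (d n)) * phi x (d n *\<^sub>C y)) \<longlonglongrightarrow> 0))"
    using assms(8)
  proof (elim disjE)
    assume "closed_under_scalars c Df \<and> closed_under_scalars c Dg \<and>
          (\<forall>x y. ((\<lambda>n. inverse (cmod (c n)) * phi (c n *\<^sub>C x) y) \<longlonglongrightarrow> 0) \<and>
                 ((\<lambda>n. inverse (cmod (c n)) * phi x (c n *\<^sub>C y)) \<longlonglongrightarrow> 0))"
    with assms(7) show ?thesis
      by (intro exI[of _ c]) simp
  next
    assume "closed_under_scalars (\<lambda>n. inverse (c n)) Df \<and>
          closed_under_scalars (\<lambda>n. inverse (c n)) Dg \<and>
          (\<forall>x y. ((\<lambda>n. cmod (c n) * phi (inverse (c n) *\<^sub>C x) y) \<longlonglongrightarrow> 0) \<and>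
                 ((\<lambda>n. cmod (c n) * phi x (inverse (c n) *\<^sub>C y)) \<longlonglongrightarrow> 0))"
    with assms(7) show ?thesis
      by (intro exI[of _ "\<lambda>n. inverse (c n)"]) (simp add: norm_inverse)
  qed
  then obtain d where "\<And>n. d n \<noteq> 0" "closed_under_scalars d Df" "closed_under_scalars d Dg"
    "\<And>x y. (\<lambda>n. inverse (cmod (d n)) * phi (d n *\<^sub>C x) y) \<longlonglongrightarrow> 0"
    "\<And>x y. (\<lambda>n. inverse (cmod (d n)) * phi x (d n *\<^sub>C y)) \<longlonglongrightarrow> 0"
    by blast
  then have "ipY (f x) y = ipX x (g y)" if "x \<in> Df" "y \<in> Dg" for x y
    by (intro perturbed_adjoint_is_exact[OF assms(1,2,4) _ _ _ _ _ that])
  with assms(6) have adj: "is_adjoint ipX ipY Df f Dg g"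
    by (simp add: is_adjoint_def)
  moreover from adj have "A_linear_on actX actY Df f"
    by (rule has_adjoint_imp_A_linear_on[OF assms(1,2)])
  moreover from adj assms(5) have "adjointable ipX ipY Df f"
    by (auto simp: adjointable_def)
  ultimately show ?thesis
    by blast
qed

end
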